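(* Let $G$ be a group and let $A \subseteq G$ be a finite subset with $|AA^{-1}| \neq |A^{-1}A|$. Then (i) $|A| \ge 4$; and (ii) if moreover $G$ has no elements of order $2$, then $|A| \ge 5$.
   Context: For a finite subset $A$ of a group $G$, the right quotient set is $AA^{-1} = \{a b^{-1} : a, b \in A\}$ and the left quotient set is $A^{-1}A = \{a^{-1} b : a, b \in A\}$. *)

theory Defs
  imports "HOL-Algebra.Coset" "HOL-Algebra.Multiplicative_Group"
begin


definition right_quotient_set :: "('a, 'b) monoid_scheme \<Rightarrow> 'a set \<Rightarrow> 'a set" where
  "right_quotient_set G A = A <#>\<^bsub>G\<^esub> (set_inv\<^bsub>G\<^esub> A)"

definition left_quotient_set :: "('a, 'b) monoid_scheme \<Rightarrow> 'a set \<Rightarrow> 'a set" where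
  "left_quotient_set G A = (set_inv\<^bsub>G\<^esub> A) <#>\<^bsub>G\<^esub> A"

end

theory Submission
  imports Defs
begin

text \<open>
  For \<open>g \<noteq> \<one>\<close> let \<open>r g\<close> be the number of representations \<open>g = x y\<^sup>-\<^sup>1\<close> with \<open>x, y \<in> A\<close>, and \<open>r' g\<close>
  that of representations \<open>g = x\<^sup>-\<^sup>1 y\<close>. Since \<open>x y\<^sup>-\<^sup>1 = z w\<^sup>-\<^sup>1\<close> iff \<open>z\<^sup>-\<^sup>1 x = w\<^sup>-\<^sup>1 y\<close>, the functions
  \<open>r\<close> and \<open>r'\<close> have the same first and second moments. If all values are at most 3, as they are
  when \<open>|A| \<le> 3\<close>, or when \<open>|A| = 4\<close> and there are no involutions, then the two quotient sets have
  the same size as soon as \<open>r\<close> and \<open>r'\<close> take the value 3 equally often. If \<open>r g = 3\<close>, then \<open>A\<close>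
  contains \<open>x, gx, g\<^sup>2x, g\<^sup>3x\<close> for some \<open>x\<close> (the last one possibly equal to \<open>x\<close>), so that
  \<open>r' (x\<^sup>-\<^sup>1gx) = 3\<close>; without involutions the value 3 is moreover taken an even number of times.
  The moments exclude the remaining cases.
\<close>

section \<open>Counting fibres and collisions of a map on a finite set\<close>

definition fibre :: "('a \<Rightarrow> 'b) \<Rightarrow> 'a set \<Rightarrow> 'b \<Rightarrow> 'a set" where
  "fibre f P g = {p \<in> P. f p = g}"

text \<open>Ordered pairs are counted, so a fibre of size \<open>k\<close> contributes
  \<open>k (k - 1)\<close>: the cardinality is the second moment of the fibre sizes minus the
  first.\<close>

definition collisions :: "('a \<Rightarrow> 'b) \<Rightarrow> 'a set \<Rightarrow> ('a \<times> 'a) set" where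
  "collisions f P = {(p, q). p \<in> P \<and> q \<in> P \<and> p \<noteq> q \<and> f p = f q}"

definition triple_values :: "('a \<Rightarrow> 'b) \<Rightarrow> 'a set \<Rightarrow> 'b set" where
  "triple_values f P = {g \<in> f ` P. card (fibre f P g) = 3}"

lemma fibre_nonempty_iff: "fibre f P g \<noteq> {} \<longleftrightarrow> g \<in> f ` P"
  by (auto simp: fibre_def)

lemma card_eq_sum_fibres:
  assumes "finite P"
  shows "card P = (\<Sum>g\<in>f ` P. card (fibre f P g))"
  using sum.image_gen[OF assms, where h = "\<lambda>_. 1::nat" and g = f] by (simp add: fibre_def)

lemma card_collisions_eq_sum_fibres:
  assumes "finite P"
  shows "card (collisions f P) = (\<Sum>g\<in>f ` P. card (fibre f P g) * (card (fibre f P g) - 1))"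
proof -
  have "collisions f P = (SIGMA p:P. fibre f P (f p) - {p})"
    by (auto simp: collisions_def fibre_def)
  moreover have "card (SIGMA p:P. fibre f P (f p) - {p}) = (\<Sum>p\<in>P. card (fibre f P (f p) - {p}))"
    using assms by (intro card_SigmaI) (auto simp: fibre_def)
  moreover have "\<dots> = (\<Sum>p\<in>P. card (fibre f P (f p)) - 1)"
    using assms by (intro sum.cong) (auto simp: fibre_def card_Diff_singleton)
  moreover have "\<dots> = (\<Sum>g\<in>f ` P. \<Sum>p\<in>{p\<in>P. f p = g}. card (fibre f P (f p)) - 1)"
    by (rule sum.image_gen[OF assms])
  moreover have "\<dots> = (\<Sum>g\<in>f ` P. card (fibre f P g) * (card (fibre f P g) - 1))"
    by (intro sum.cong) (auto simp: fibre_def)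
  ultimately show ?thesis by simp
qed

text \<open>The identity determines the image size from \<open>card P\<close>, the number of
  collisions and the number of triple values. The three inequalities follow by comparing both sides
  fibre by fibre; they serve to rule out unequal numbers of triple values.\<close>

lemma image_card_collisions:
  assumes fin: "finite P" and le3: "\<And>g. g \<in> f ` P \<Longrightarrow> card (fibre f P g) \<le> 3"
  shows "2 * card (f ` P) + card (collisions f P) = 2 * card P + 2 * card (triple_values f P)"
    and "card P \<le> 3 * card (f ` P)"
    and "6 * card (triple_values f P) \<le> card (collisions f P)"
    and "3 * card (triple_values f P) \<le> card P"
proof -
  let ?r = "\<lambda>g. card (fibre f P g)"
  have t: "card (triple_values f P) = (\<Sum>g\<in>f ` P. if ?r g = 3 then 1 else 0)"
    unfolding triple_values_def card_eq_sum by (rule sum.inter_filter) (use fin in simp)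
  have pos: "?r g \<in> {1, 2, 3}" if "g \<in> f ` P" for g
  proof -
    have "fibre f P g \<noteq> {}" "finite (fibre f P g)" using that fin by (auto simp: fibre_def)
    then have "?r g \<noteq> 0" by simp
    then show ?thesis using le3[OF that] by auto
  qed
  \<comment> \<open>For \<open>k \<in> {1, 2, 3}\<close>, \<open>2 + k (k - 1)\<close> agrees with \<open>2 k\<close> up to a correction 2 at \<open>k = 3\<close>.\<close>
  have "(\<Sum>g\<in>f ` P. 2 + ?r g * (?r g - 1)) = (\<Sum>g\<in>f ` P. 2 * ?r g + 2 * (if ?r g = 3 then 1 else 0))"
    by (intro sum.cong refl) (use pos in force)
  then show "2 * card (f ` P) + card (collisions f P) = 2 * card P + 2 * card (triple_values f P)"
    unfolding t card_eq_sum_fibres[OF fin, of f] card_collisions_eq_sum_fibres[OF fin]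
    by (simp only: sum.distrib sum_distrib_left) simp
  have "(\<Sum>g\<in>f ` P. ?r g) \<le> (\<Sum>g\<in>f ` P. 3)" by (intro sum_mono le3)
  then show "card P \<le> 3 * card (f ` P)"
    using card_eq_sum_fibres[OF fin, of f] by simp
  have "(\<Sum>g\<in>f ` P. 6 * (if ?r g = 3 then 1 else 0)) \<le> (\<Sum>g\<in>f ` P. ?r g * (?r g - 1))"
    by (intro sum_mono) auto
  then show "6 * card (triple_values f P) \<le> card (collisions f P)"
    unfolding t card_collisions_eq_sum_fibres[OF fin] by (simp only: sum_distrib_left)
  have "(\<Sum>g\<in>f ` P. 3 * (if ?r g = 3 then 1 else 0)) \<le> (\<Sum>g\<in>f ` P. ?r g)"
    by (intro sum_mono) auto
  then show "3 * card (triple_values f P) \<le> card P"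
    unfolding t card_eq_sum_fibres[OF fin, of f] by (simp only: sum_distrib_left)
qed

text \<open>The orbits \<open>{x, i x}\<close> all have two elements; removing one of them leaves a
  smaller set of the same kind.\<close>

lemma even_card_involution:
  assumes "finite S" "\<And>x. x \<in> S \<Longrightarrow> i x \<in> S" "\<And>x. x \<in> S \<Longrightarrow> i (i x) = x"
    "\<And>x. x \<in> S \<Longrightarrow> i x \<noteq> x"
  shows "even (card S)"
  using assms
proof (induction "card S" arbitrary: S rule: less_induct)
  case less
  show ?case
  proof (cases "S = {}")
    case False
    then obtain x where x: "x \<in> S" by blast
    let ?T = "S - {x, i x}"
    have c: "card S = card ?T + 2"
      using x less.prems card_Diff_subset[of "{x, i x}" S] card_mono[of S "{x, i x}"] by fastforce
    have "even (card ?T)"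
    proof (rule less.hyps)
      show "card ?T < card S" using c by simp
      show "i y \<in> ?T" if "y \<in> ?T" for y
        using that x less.prems(2-4) by (metis Diff_iff insert_iff empty_iff)
    qed (use less.prems in auto)
    then show ?thesis using c by simp
  qed simp
qed

section \<open>Quotients in a group and inversion of sets\<close>

context group
begin

definition quot :: "'a \<times> 'a \<Rightarrow> 'a" where
  "quot p = fst p \<otimes> inv (snd p)"

lemma quot_swap:
  assumes "x \<in> carrier G" "y \<in> carrier G"
  shows "quot (y, x) = inv (quot (x, y))"
  using assms by (simp add: quot_def inv_mult_group)

lemma quot_eq_iff:
  assumes "x \<in> carrier G" "y \<in> carrier G" "g \<in> carrier G"
  shows "quot (x, y) = g \<longleftrightarrow> x = g \<otimes> y"
  unfolding quot_def using assms inv_solve_right'[of g x y] by simp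

lemma set_inv_eq_image: "set_inv A = m_inv G ` A"
  by (auto simp: SET_INV_def)

lemma set_inv_set_inv: "A \<subseteq> carrier G \<Longrightarrow> set_inv (set_inv A) = A"
  by (force simp: set_inv_eq_image image_image)

lemma set_inv_carrier: "A \<subseteq> carrier G \<Longrightarrow> set_inv A \<subseteq> carrier G"
  by (auto simp: set_inv_eq_image)

lemma card_set_inv: "A \<subseteq> carrier G \<Longrightarrow> card (set_inv A) = card A"
  unfolding set_inv_eq_image by (meson card_image inj_on_subset inv_inj)

text \<open>This reduces the problem to right quotients of \<open>A\<close> and of its inverse set,
  so that each later fact is proved once and applied to both.\<close>

lemma left_quotient_set_eq:
  assumes "A \<subseteq> carrier G"
  shows "left_quotient_set G A = right_quotient_set G (set_inv A)"
  unfolding left_quotient_set_def right_quotient_set_def using set_inv_set_inv[OF assms] by simp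

text \<open>The diagonal yields exactly the value \<open>\<one>\<close>, with multiplicity
  \<open>card A\<close>. It is split off because for \<open>card A = 4\<close> this multiplicity
  would break the bound 3 on fibre sizes.\<close>

lemma card_right_quotient_set:
  assumes A: "A \<subseteq> carrier G" "finite A" "A \<noteq> {}"
  shows "card (right_quotient_set G A) = Suc (card (quot ` (A \<times> A - Id)))"
proof -
  have "right_quotient_set G A = insert \<one> (quot ` (A \<times> A - Id))"
  proof -
    have "right_quotient_set G A = quot ` (A \<times> A)"
      by (force simp: right_quotient_set_def set_mult_def set_inv_eq_image quot_def)
    also have "A \<times> A = (\<lambda>x. (x, x)) ` A \<union> (A \<times> A - Id)" by auto
    also have "quot ` \<dots> = quot ` (\<lambda>x. (x, x)) ` A \<union> quot ` (A \<times> A - Id)" by (rule image_Un)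
    also have "quot ` (\<lambda>x. (x, x)) ` A = {\<one>}"
      using A by (auto simp: quot_def image_iff subset_iff)
    finally show ?thesis by simp
  qed
  moreover have "\<one> \<notin> quot ` (A \<times> A - Id)"
  proof
    assume "\<one> \<in> quot ` (A \<times> A - Id)"
    then obtain p where "p \<in> A \<times> A - Id" "quot p = \<one>" by (metis imageE)
    then show False using A quot_eq_iff[of "fst p" "snd p" \<one>] by (cases p) auto
  qed
  ultimately show ?thesis using A by simp
qed

section \<open>Equality of the collision counts\<close>

text \<open>The regrouping of \<open>x y\<^sup>-\<^sup>1 = z w\<^sup>-\<^sup>1\<close> into \<open>z\<^sup>-\<^sup>1 x = w\<^sup>-\<^sup>1 y\<close> maps off-diagonal collisions of \<open>A\<close>
  injectively to those of \<open>A\<^sup>-\<^sup>1\<close>.\<close>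

lemma card_collisions_le:
  assumes A: "A \<subseteq> carrier G" "finite A"
  shows "card (collisions quot (A \<times> A - Id))
    \<le> card (collisions quot ((set_inv A) \<times> (set_inv A) - Id))"
proof -
  let ?h = "\<lambda>((x, y), (z, w)). ((inv z, inv x), (inv w, inv y))"
  have inj: "inv x = inv y \<longleftrightarrow> x = y" if "x \<in> A" "y \<in> A" for x y
    using that A by (metis inv_inv subsetD)
  show ?thesis
  proof (rule card_inj_on_le[of ?h])
    show "inj_on ?h (collisions quot (A \<times> A - Id))"
      by (auto simp: inj_on_def collisions_def inj)
    show "?h ` collisions quot (A \<times> A - Id) \<subseteq> collisions quot ((set_inv A) \<times> (set_inv A) - Id)"
    proof clarify
      fix x y z w assume "((x, y), (z, w)) \<in> collisions quot (A \<times> A - Id)"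
      then have i: "x \<in> A" "y \<in> A" "z \<in> A" "w \<in> A" and n: "x \<noteq> y" "z \<noteq> w" "(x, y) \<noteq> (z, w)"
        and e: "quot (x, y) = quot (z, w)" by (auto simp: collisions_def)
      have c: "x \<in> carrier G" "y \<in> carrier G" "z \<in> carrier G" "w \<in> carrier G"
        using i A by auto
      have e': "x = z \<otimes> (inv w \<otimes> y)"
        using e c quot_eq_iff[of x y "quot (z, w)"] by (simp add: quot_def m_assoc)
      have q: "quot (inv z, inv x) = quot (inv w, inv y)"
        unfolding quot_def using c e' by (simp add: m_assoc[symmetric])
      \<comment> \<open>The two requirements trade places: distinctness of the old pairs makes the
        new pairs off-diagonal, while \<open>x \<noteq> y\<close> makes the new pairs
        distinct.\<close>
      have "x \<noteq> z"
      proof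
        assume "x = z"
        then have "inv w \<otimes> y = \<one>" using e' c by auto
        then have "y = w" using c by (metis inv_equality inv_inv inv_closed)
        then show False using \<open>x = z\<close> n by simp
      qed
      moreover have "y \<noteq> w"
      proof
        assume "y = w"
        then have "x = z" using e' c by simp
        then show False using \<open>y = w\<close> n by simp
      qed
      ultimately show "((inv z, inv x), (inv w, inv y)) \<in> collisions quot ((set_inv A) \<times> (set_inv A) - Id)"
        using i n q by (auto simp: collisions_def set_inv_eq_image inj)
    qed
    show "finite (collisions quot ((set_inv A) \<times> (set_inv A) - Id))"
      by (rule finite_subset[of _ "((set_inv A) \<times> (set_inv A)) \<times> ((set_inv A) \<times> (set_inv A))"])
        (use A in \<open>auto simp: collisions_def set_inv_eq_image\<close>)
  qed
qed

lemma card_collisions_set_inv: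
  assumes A: "A \<subseteq> carrier G" "finite A"
  shows "card (collisions quot ((set_inv A) \<times> (set_inv A) - Id))
    = card (collisions quot (A \<times> A - Id))"
proof (rule antisym)
  have "finite (set_inv A)" using A by (simp add: set_inv_eq_image)
  from card_collisions_le[OF set_inv_carrier[OF A(1)] this]
  show "card (collisions quot ((set_inv A) \<times> (set_inv A) - Id))
    \<le> card (collisions quot (A \<times> A - Id))"
    unfolding set_inv_set_inv[OF A(1)] .
qed (rule card_collisions_le[OF A])

lemma card_off_diagonal: "finite A \<Longrightarrow> card (A \<times> A - Id) = card A * card A - card A"
proof -
  assume "finite A"
  moreover have "A \<times> A - Id = A \<times> A - (\<lambda>x. (x, x)) ` A" by auto
  moreover have "card ((\<lambda>x. (x, x)) ` A) = card A" by (simp add: card_image inj_on_def)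
  ultimately show ?thesis by (simp add: card_Diff_subset card_cartesian_product image_subset_iff)
qed

section \<open>Multiplicities of individual quotients\<close>

lemma card_fibre_quot:
  assumes A: "A \<subseteq> carrier G" and g: "g \<in> carrier G" "g \<noteq> \<one>"
  shows "card (fibre quot (A \<times> A - Id) g) = card {x \<in> A. g \<otimes> x \<in> A}"
proof -
  have "fibre quot (A \<times> A - Id) g = (\<lambda>x. (g \<otimes> x, x)) ` {x \<in> A. g \<otimes> x \<in> A}"
  proof -
    have "quot (x, y) = g \<longleftrightarrow> x = g \<otimes> y" "g \<otimes> y \<noteq> y" if "x \<in> A" "y \<in> A" for x y
      using that A g by (auto simp: quot_eq_iff subset_iff)
    then show ?thesis by (fastforce simp: fibre_def image_iff simp del: ex_simps)
  qed
  then show ?thesis by (simp add: card_image inj_on_def)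
qed

lemma quot_off_diagonal:
  assumes A: "A \<subseteq> carrier G" and g: "g \<in> quot ` (A \<times> A - Id)"
  shows "g \<in> carrier G" "g \<noteq> \<one>"
proof -
  obtain x y where "x \<in> A" "y \<in> A" "x \<noteq> y" "g = quot (x, y)" using g by auto
  then show "g \<in> carrier G" "g \<noteq> \<one>" using A quot_eq_iff[of x y \<one>]
    by (auto simp: quot_def)
qed

lemma ord_eq_2I:
  assumes "g \<in> carrier G" "g \<noteq> \<one>" "g \<otimes> g = \<one>"
  shows "ord g = 2"
proof -
  have "g [^] (2::nat) = \<one>" using assms by (simp add: numeral_2_eq_2)
  then have dvd: "ord g dvd 2" using assms pow_eq_id by blast
  then have "ord g \<le> 2" by (rule dvd_imp_le) simp
  \<comment> \<open>\<open>ord\<close> has the value 0 on elements of infinite order, so the upper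
    bound alone does not settle this case.\<close>
  moreover have "ord g \<noteq> 0"
  proof
    assume "ord g = 0"
    then show False using dvd by simp
  qed
  moreover have "ord g \<noteq> 1" using assms ord_eq_1 by blast
  ultimately show ?thesis by linarith
qed

text \<open>A fibre injects into \<open>A\<close>, so only \<open>card A = 4\<close> needs work.
  With four representations, left multiplication by \<open>g\<close> would permute \<open>A\<close>
  without fixed points, as a 4-cycle or as two swaps; then \<open>g^2\<close> or \<open>g\<close>
  would be an involution.\<close>

lemma card_fibre_le_3:
  assumes A: "A \<subseteq> carrier G" "finite A"
    and small: "card A \<le> 3 \<or> card A = 4 \<and> (\<forall>x \<in> carrier G. ord x \<noteq> 2)"
    and g: "g \<in> quot ` (A \<times> A - Id)"
  shows "card (fibre quot (A \<times> A - Id) g) \<le> 3"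
proof -
  note gc = quot_off_diagonal[OF A(1) g]
  let ?S = "{x \<in> A. g \<otimes> x \<in> A}"
  have c: "card (fibre quot (A \<times> A - Id) g) = card ?S" by (rule card_fibre_quot[OF A(1) gc])
  have le: "card ?S \<le> card A" using A by (simp add: card_mono)
  show ?thesis
  proof (rule ccontr)
    assume "\<not> ?thesis"
    then have 4: "card A = 4" "card ?S = card A" and no2: "\<forall>x \<in> carrier G. ord x \<noteq> 2"
      using c le small by auto
    have "?S = A" using 4 A by (intro card_subset_eq) auto
    then have cl: "g \<otimes> x \<in> A" if "x \<in> A" for x using that by auto
    have nofix: "g \<otimes> x \<noteq> x" if "x \<in> A" for x using that A gc by auto
    have gg: "g \<otimes> g \<noteq> \<one>" using no2 ord_eq_2I gc by blast
    have fix2: "g \<otimes> (g \<otimes> x) \<noteq> x" if "x \<in> A" for x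
      using that A gc gg by (metis m_assoc m_closed r_cancel_one' subsetD)
    have g4: "g \<otimes> (g \<otimes> (g \<otimes> (g \<otimes> x))) \<noteq> x" if "x \<in> A" for x
    proof
      assume *: "g \<otimes> (g \<otimes> (g \<otimes> (g \<otimes> x))) = x"
      have "(g \<otimes> g) \<otimes> (g \<otimes> g) \<otimes> x = x" using that A gc * by (auto simp: m_assoc subset_iff)
      then have "(g \<otimes> g) \<otimes> (g \<otimes> g) = \<one>" using that A gc by (metis m_closed r_cancel_one' subsetD)
      then show False using no2 ord_eq_2I[of "g \<otimes> g"] gg gc by auto
    qed
    have inj: "g \<otimes> x = g \<otimes> y \<longleftrightarrow> x = y" if "x \<in> A" "y \<in> A" for x y
      using that A gc by (auto simp: subset_iff)
    obtain x where x: "x \<in> A" using 4 by fastforce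
    have d: "card {x, g \<otimes> x, g \<otimes> (g \<otimes> x)} = 3"
      using nofix[OF x, symmetric] nofix[OF cl[OF x], symmetric] fix2[OF x, symmetric] by simp
    obtain y where y: "A - {x, g \<otimes> x, g \<otimes> (g \<otimes> x)} = {y}"
    proof -
      have "card (A - {x, g \<otimes> x, g \<otimes> (g \<otimes> x)}) = 1"
        using d 4 x cl by (subst card_Diff_subset) auto
      then show ?thesis using that by (metis card_1_singletonE)
    qed
    have y': "y \<in> A" "y \<noteq> x" "y \<noteq> g \<otimes> x" "y \<noteq> g \<otimes> (g \<otimes> x)" using y by blast+
    have cover: "z = x \<or> z = g \<otimes> x \<or> z = g \<otimes> (g \<otimes> x) \<or> z = y" if "z \<in> A" for z
      using y that by blast
    \<comment> \<open>Injectivity closes the chain: \<open>x\<close> is the only image left for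
      \<open>y\<close>, and then \<open>y\<close> the only one left for \<open>g^2 x\<close>. So
      \<open>g^4\<close> fixes \<open>x\<close>.\<close>
    have gy: "g \<otimes> y = x"
      using cover[OF cl[OF y'(1)]] nofix[OF y'(1)] y'(2,3)
        inj[OF y'(1) x] inj[OF y'(1) cl[OF x]] by blast
    have "g \<otimes> (g \<otimes> (g \<otimes> x)) = y"
      using cover[OF cl[OF cl[OF cl[OF x]]]] nofix[OF cl[OF cl[OF x]]] fix2[OF x] y'(4) gy
        inj[OF cl[OF cl[OF x]] x] inj[OF cl[OF cl[OF x]] y'(1)] by auto
    then show False using g4[OF x] gy by simp
  qed
qed

text \<open>Only the existence of a triple value is transferred; parity and the moment bounds later
  upgrade this to equal numbers.\<close>

lemma triple_values_set_inv:
  assumes A: "A \<subseteq> carrier G" "finite A"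
    and small: "card A \<le> 3 \<or> card A = 4 \<and> (\<forall>x \<in> carrier G. ord x \<noteq> 2)"
    and ne: "triple_values quot (A \<times> A - Id) \<noteq> {}"
  shows "triple_values quot ((set_inv A) \<times> (set_inv A) - Id) \<noteq> {}"
proof -
  obtain g where g: "g \<in> quot ` (A \<times> A - Id)" and r3: "card (fibre quot (A \<times> A - Id) g) = 3"
    using ne by (auto simp: triple_values_def)
  note gc = quot_off_diagonal[OF A(1) g]
  let ?S = "{x \<in> A. g \<otimes> x \<in> A}"
  have c3: "card ?S = 3" using card_fibre_quot[OF A(1) gc] r3 by simp
  have nofix: "g \<otimes> x \<noteq> x" if "x \<in> A" for x using that A gc by auto
  have inj: "g \<otimes> x = g \<otimes> y \<longleftrightarrow> x = y" if "x \<in> A" "y \<in> A" for x y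
    using that A gc by (auto simp: subset_iff)
  obtain a b c where S: "?S = {a, b, c}" and abc: "a \<noteq> b" "a \<noteq> c" "b \<noteq> c"
    using c3 by (auto simp: card_3_iff)
  have in_A: "a \<in> A" "b \<in> A" "c \<in> A" and im: "g \<otimes> a \<in> A" "g \<otimes> b \<in> A" "g \<otimes> c \<in> A"
    using S by blast+
  have fix2: "g \<otimes> (g \<otimes> x) \<noteq> x" if "x \<in> A" "card A = 4" for x
  proof -
    have "g \<otimes> g \<noteq> \<one>" using small that ord_eq_2I gc by auto
    then show ?thesis using that A gc by (metis m_assoc m_closed r_cancel_one' subsetD)
  qed
  \<comment> \<open>Left multiplication by \<open>g\<close> gives three arrows inside
    \<open>A\<close>, starting at \<open>a\<close>, \<open>b\<close>, \<open>c\<close>, with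
    distinct targets and no loops. The claim is that the starting points contain a chain of three
    distinct points.\<close>
  have "\<exists>x. x \<in> {a, b, c} \<and> g \<otimes> x \<in> {a, b, c} \<and> g \<otimes> (g \<otimes> x) \<in> {a, b, c} \<and> g \<otimes> (g \<otimes> x) \<noteq> x"
  proof (cases "card A = 4")
    case True
    have "card (A - {a, b, c}) = 1" using True in_A abc by (subst card_Diff_subset) auto
    then obtain d where "A - {a, b, c} = {d}" by (metis card_1_singletonE)
    then have cover: "z = a \<or> z = b \<or> z = c \<or> z = d" if "z \<in> A" for z using that by blast
    have ga: "g \<otimes> a = b \<or> g \<otimes> a = c \<or> g \<otimes> a = d"
      and gb: "g \<otimes> b = a \<or> g \<otimes> b = c \<or> g \<otimes> b = d"
      and gc3: "g \<otimes> c = a \<or> g \<otimes> c = b \<or> g \<otimes> c = d"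
      using cover[OF im(1)] cover[OF im(2)] cover[OF im(3)] nofix[OF in_A(1)] nofix[OF in_A(2)] nofix[OF in_A(3)]
      by blast+
    have no_swap: "\<not> (g \<otimes> a = b \<and> g \<otimes> b = a)" "\<not> (g \<otimes> a = c \<and> g \<otimes> c = a)" "\<not> (g \<otimes> b = c \<and> g \<otimes> c = b)"
      using fix2[OF in_A(1) True] fix2[OF in_A(2) True] by auto
    have ne: "g \<otimes> a \<noteq> g \<otimes> b" "g \<otimes> a \<noteq> g \<otimes> c" "g \<otimes> b \<noteq> g \<otimes> c"
      using inj in_A abc by blast+
    \<comment> \<open>At most one arrow ends in \<open>d\<close>, so two of them stay in
      \<open>{a, b, c}\<close>; with distinct sources and targets and no swap, they must be
      composable.\<close>
    have "g \<otimes> a = b \<and> g \<otimes> b = c \<or> g \<otimes> a = c \<and> g \<otimes> c = b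
      \<or> g \<otimes> b = a \<and> g \<otimes> a = c \<or> g \<otimes> b = c \<and> g \<otimes> c = a
      \<or> g \<otimes> c = a \<and> g \<otimes> a = b \<or> g \<otimes> c = b \<and> g \<otimes> b = a"
      using ga gb gc3 no_swap ne by (smt (verit))
    then have "g \<otimes> a \<in> {a, b, c} \<and> g \<otimes> (g \<otimes> a) \<in> {a, b, c}
      \<or> g \<otimes> b \<in> {a, b, c} \<and> g \<otimes> (g \<otimes> b) \<in> {a, b, c}
      \<or> g \<otimes> c \<in> {a, b, c} \<and> g \<otimes> (g \<otimes> c) \<in> {a, b, c}"
      by (elim disjE conjE) simp_all
    then show ?thesis
      using fix2[OF in_A(1) True] fix2[OF in_A(2) True] fix2[OF in_A(3) True] by blast
  next
    case False
    then have "card A \<le> 3" using small by simp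
    then have AS: "A = {a, b, c}"
      using S A c3 by (metis (no_types, lifting) card_seteq mem_Collect_eq subsetI)
    have "g \<otimes> a = b \<or> g \<otimes> a = c" "g \<otimes> b = a \<or> g \<otimes> b = c" "g \<otimes> c = a \<or> g \<otimes> c = b"
      using im nofix[OF in_A(1)] nofix[OF in_A(2)] nofix[OF in_A(3)] unfolding AS by blast+
    moreover have "g \<otimes> a \<noteq> g \<otimes> b" "g \<otimes> a \<noteq> g \<otimes> c" "g \<otimes> b \<noteq> g \<otimes> c"
      using inj in_A abc by blast+
    ultimately have "g \<otimes> a = b \<and> g \<otimes> b = c \<or> g \<otimes> a = c \<and> g \<otimes> c = b" by (smt (verit))
    then have "g \<otimes> a \<in> {a, b, c} \<and> g \<otimes> (g \<otimes> a) \<in> {a, b, c} \<and> g \<otimes> (g \<otimes> a) \<noteq> a"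
      using abc by (elim disjE conjE) simp_all
    then show ?thesis by blast
  qed
  then obtain x where x: "x \<in> ?S" "g \<otimes> x \<in> ?S" "g \<otimes> (g \<otimes> x) \<in> ?S" "g \<otimes> (g \<otimes> x) \<noteq> x"
    unfolding S by blast
  \<comment> \<open>Conjugation by \<open>x\<close> gives \<open>g y = y ?h\<close> for each
    \<open>y\<close> among \<open>x, gx, g^2 x\<close>. Inverting, \<open>?h\<close> sends
    \<open>inv (g y)\<close> to \<open>inv y\<close>, which yields three representations of
    \<open>?h\<close> over the inverse set.\<close>
  let ?B = "set_inv A" and ?h = "inv x \<otimes> g \<otimes> x"
  have xc: "x \<in> carrier G" using x A by auto
  have hc: "?h \<in> carrier G" using xc gc by simp
  have hne: "?h \<noteq> \<one>"
  proof
    assume "?h = \<one>"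
    then have "g \<otimes> x = x" using xc gc by (metis inv_closed inv_equality inv_inv m_assoc m_closed)
    then show False using nofix x by auto
  qed
  have conj: "?h \<otimes> inv (g \<otimes> y) = inv y" if "y \<in> carrier G" "g \<otimes> y = y \<otimes> ?h" for y
    using that hc by (metis inv_closed inv_mult_group m_assoc m_closed r_inv r_one)
  have comm: "g \<otimes> x = x \<otimes> ?h" using xc gc by (simp add: m_assoc[symmetric])
  then have comm2: "g \<otimes> (g \<otimes> x) = g \<otimes> x \<otimes> ?h"
    using xc gc hc by (metis m_assoc)
  then have comm3: "g \<otimes> (g \<otimes> (g \<otimes> x)) = g \<otimes> (g \<otimes> x) \<otimes> ?h"
    using xc gc hc by (metis m_assoc m_closed)
  let ?T = "{u \<in> ?B. ?h \<otimes> u \<in> ?B}"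
  let ?y1 = "g \<otimes> x" let ?y2 = "g \<otimes> ?y1" let ?y3 = "g \<otimes> ?y2"
  have yA: "x \<in> A" "?y1 \<in> A" "?y2 \<in> A" "?y3 \<in> A" using x by auto
  have yc: "?y1 \<in> carrier G" "?y2 \<in> carrier G" "?y3 \<in> carrier G" using xc gc by auto
  have "inv ?y1 \<in> ?T" "inv ?y2 \<in> ?T" "inv ?y3 \<in> ?T"
    using yA by (auto simp: conj[OF xc comm] conj[OF yc(1) comm2] conj[OF yc(2) comm3] set_inv_eq_image)
  then have sub: "{inv ?y1, inv ?y2, inv ?y3} \<subseteq> ?T" by blast
  have neq: "?y1 \<noteq> ?y2" "?y2 \<noteq> ?y3" "?y1 \<noteq> ?y3"
    using nofix[OF yA(2)] nofix[OF yA(3)] inj[OF yA(1,3)] x(4) by auto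
  have inv_inj_iff: "inv u = inv v \<longleftrightarrow> u = v" if "u \<in> carrier G" "v \<in> carrier G" for u v
    using that by (metis inv_inv)
  have "card {inv ?y1, inv ?y2, inv ?y3} = 3"
    using neq yc by (simp add: inv_inj_iff)
  moreover have "finite ?T" using A by (simp add: set_inv_eq_image)
  ultimately have T3: "3 \<le> card ?T" using card_mono[OF _ sub] by simp
  have B: "?B \<subseteq> carrier G" "finite ?B" "card ?B = card A"
    using A set_inv_carrier card_set_inv by (auto simp: set_inv_eq_image)
  have r: "card (fibre quot (?B \<times> ?B - Id) ?h) = card ?T"
    by (rule card_fibre_quot[OF B(1) hc hne])
  then have "fibre quot (?B \<times> ?B - Id) ?h \<noteq> {}" using T3 by auto
  then have h: "?h \<in> quot ` (?B \<times> ?B - Id)" by (simp add: fibre_nonempty_iff)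
  have "card (fibre quot (?B \<times> ?B - Id) ?h) = 3"
    using card_fibre_le_3[OF B(1,2) _ h] small T3 r B(3) by simp
  then show ?thesis using h unfolding triple_values_def by blast
qed

text \<open>Swapping \<open>x\<close> and \<open>y\<close> in each representation shows that
  \<open>g\<close> and \<open>inv g\<close> have equal multiplicity, and \<open>g = inv g\<close>
  would make \<open>g\<close> an involution.\<close>

lemma even_card_triple_values:
  assumes A: "A \<subseteq> carrier G" "finite A" and no2: "\<forall>x \<in> carrier G. ord x \<noteq> 2"
  shows "even (card (triple_values quot (A \<times> A - Id)))"
proof (rule even_card_involution[where i = "m_inv G"])
  let ?P = "A \<times> A - Id"
  show "finite (triple_values quot ?P)" using A by (simp add: triple_values_def)
  fix g assume t: "g \<in> triple_values quot ?P"
  then have g: "g \<in> quot ` ?P" by (simp add: triple_values_def)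
  note gc = quot_off_diagonal[OF A(1) g]
  show "inv (inv g) = g" using gc by simp
  show "inv g \<noteq> g" using no2 ord_eq_2I gc r_inv by metis
  have "fibre quot ?P (inv g) = prod.swap ` fibre quot ?P g"
  proof -
    have "quot (y, x) = inv g \<longleftrightarrow> quot (x, y) = g" if "x \<in> A" "y \<in> A" for x y
    proof -
      have "x \<in> carrier G" "y \<in> carrier G" using that A by auto
      moreover from this have "quot (x, y) \<in> carrier G" by (simp add: quot_def)
      ultimately show ?thesis using gc by (metis quot_swap inv_inv)
    qed
    then show ?thesis by (force simp: fibre_def image_iff)
  qed
  then have c: "card (fibre quot ?P (inv g)) = 3"
    using t by (simp add: card_image triple_values_def)
  then have "fibre quot ?P (inv g) \<noteq> {}" by auto
  then have "inv g \<in> quot ` ?P" by (simp add: fibre_nonempty_iff)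
  then show "inv g \<in> triple_values quot ?P" using c by (simp add: triple_values_def)
qed

section \<open>Comparison of the two quotient sets\<close>

lemma card_right_quotient_set_inv:
  assumes A: "A \<subseteq> carrier G" "finite A"
    and small: "card A \<le> 3 \<or> card A = 4 \<and> (\<forall>x \<in> carrier G. ord x \<noteq> 2)"
  shows "card (right_quotient_set G (set_inv A)) = card (right_quotient_set G A)"
\<comment> \<open>The empty set is separate because it has no diagonal to supply
  \<open>\<one>\<close>, so the successor formula for the quotient set fails.\<close>
proof (cases "A = {}")
  case True
  then show ?thesis by (simp add: set_inv_eq_image)
next
  case False
  let ?B = "set_inv A"
  let ?P = "A \<times> A - Id" and ?Q = "?B \<times> ?B - Id"
  have B: "?B \<subseteq> carrier G" "finite ?B" "card ?B = card A" "?B \<noteq> {}"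
    using A False set_inv_carrier card_set_inv by (auto simp: set_inv_eq_image)
  have smallB: "card ?B \<le> 3 \<or> card ?B = 4 \<and> (\<forall>x \<in> carrier G. ord x \<noteq> 2)"
    using small B(3) by simp
  have fin: "finite ?P" "finite ?Q" using A B by auto
  have P: "card ?P = card A * card A - card A" "card ?Q = card A * card A - card A"
    using card_off_diagonal[OF A(2)] card_off_diagonal[OF B(2)] B(3) by simp_all
  have le3: "\<And>g. g \<in> quot ` ?P \<Longrightarrow> card (fibre quot ?P g) \<le> 3"
    "\<And>g. g \<in> quot ` ?Q \<Longrightarrow> card (fibre quot ?Q g) \<le> 3"
    using card_fibre_le_3[OF A small] card_fibre_le_3[OF B(1,2) smallB] by blast+
  have cP: "2 * card (quot ` ?P) + card (collisions quot ?P) = 2 * card ?P + 2 * card (triple_values quot ?P)"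
    "card ?P \<le> 3 * card (quot ` ?P)" "6 * card (triple_values quot ?P) \<le> card (collisions quot ?P)"
    "3 * card (triple_values quot ?P) \<le> card ?P"
    using image_card_collisions[where f = quot, OF fin(1)] le3(1) by blast+
  have cQ: "2 * card (quot ` ?Q) + card (collisions quot ?Q) = 2 * card ?Q + 2 * card (triple_values quot ?Q)"
    "card ?Q \<le> 3 * card (quot ` ?Q)" "6 * card (triple_values quot ?Q) \<le> card (collisions quot ?Q)"
    "3 * card (triple_values quot ?Q) \<le> card ?Q"
    using image_card_collisions[where f = quot, OF fin(2)] le3(2) by blast+
  note coll = card_collisions_set_inv[OF A]
  have "triple_values quot ?P = {} \<longleftrightarrow> triple_values quot ?Q = {}"
    using triple_values_set_inv[OF A small] triple_values_set_inv[OF B(1,2) smallB]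
    by (auto simp: set_inv_set_inv[OF A(1)])
  moreover have "finite (triple_values quot ?P)" "finite (triple_values quot ?Q)"
    using fin by (simp_all add: triple_values_def)
  ultimately have zero: "card (triple_values quot ?P) = 0 \<longleftrightarrow> card (triple_values quot ?Q) = 0"
    by simp
  have "card (triple_values quot ?P) = card (triple_values quot ?Q)"
    using small
  proof
    assume "card A \<le> 3"
    then have "card A * card A - card A \<le> 6"
      by (cases "card A = 0 \<or> card A = 1 \<or> card A = 2 \<or> card A = 3") auto
    then have le6: "card ?P \<le> 6" "card ?Q \<le> 6" and eq: "card ?P = card ?Q"
      using P by simp_all
    have "card (triple_values quot ?P) \<in> {0, 1, 2}" "card (triple_values quot ?Q) \<in> {0, 1, 2}"
      using le6 cP(4) cQ(4) by auto
    \<comment> \<open>Only 1 against 2 could differ. Two triple values force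
      \<open>card ?P = 6\<close> and at least 12 collisions; one triple value, with at least 2
      distinct quotients, allows at most 14 - 4 = 10.\<close>
    then show ?thesis using cP cQ coll zero le6 eq by auto
  next
    assume 4: "card A = 4 \<and> (\<forall>x \<in> carrier G. ord x \<noteq> 2)"
    have "even (card (triple_values quot ?P))" "even (card (triple_values quot ?Q))"
      using 4 even_card_triple_values[OF A] even_card_triple_values[OF B(1,2)] by blast+
    then obtain p q where pq: "card (triple_values quot ?P) = 2 * p" "card (triple_values quot ?Q) = 2 * q"
      by (auto elim!: evenE)
    have "card ?P = 12" "card ?Q = 12" using P 4 by simp_all
    moreover have "p \<in> {0, 1, 2}" "q \<in> {0, 1, 2}"
      using calculation pq cP(4) cQ(4) by auto
    \<comment> \<open>Only 2 against 4 triple values is left. Four force at least 24 collisions;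
      two, with at least 4 distinct quotients, allow at most 28 - 8 = 20.\<close>
    ultimately show ?thesis using cP cQ coll zero unfolding pq by auto
  qed
  then have "card (quot ` ?P) = card (quot ` ?Q)" using cP(1) cQ(1) coll P by linarith
  then show ?thesis
    using card_right_quotient_set[OF A False] card_right_quotient_set[OF B(1,2,4)] by simp
qed

end

theorem theorem1p6:
  fixes G :: "('a, 'b) monoid_scheme" and A :: "'a set"
  assumes "group G"
    and "A \<subseteq> carrier G"
    and "finite A"
    and "card (right_quotient_set G A) \<noteq> card (left_quotient_set G A)"
  shows "card A \<ge> 4 \<and>
    ((\<forall>x \<in> carrier G. group.ord G x \<noteq> 2) \<longrightarrow> card A \<ge> 5)"
proof -
  interpret group G by fact
  have "\<not> (card A \<le> 3 \<or> card A = 4 \<and> (\<forall>x \<in> carrier G. ord x \<noteq> 2))"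
    using card_right_quotient_set_inv[OF assms(2,3)] left_quotient_set_eq[OF assms(2)] assms(4)
    by auto
  then show ?thesis by auto
qed

end
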